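(* Let $q$ be a prime power, $m$ a positive integer, and let $D\subseteq\mathbb{F}_{q^m}^*$ be an $\mathbb{F}_q^*$-invariant partial difference set with parameters $(q^m,k,\lambda,\mu)$, whose Cayley graph $\mathrm{Cay}(\mathbb{F}_{q^m},D)$ has restricted eigenvalues $\theta_1>0>\theta_2$ with multiplicities $m_1$ and $m_2$ respectively. Then, as $(u,v)$ ranges over $\mathbb{F}_q\times\mathbb{F}_{q^m}$, the Hamming weight of the codeword $c(u,v)$ of $\mathcal C(M_D)$ equals: $0$ for exactly $1$ pair; $k$ for exactly $q-1$ pairs (namely $u\ne0,v=0$); $q^m-q^{m-1}$ for exactly $q^m-1$ pairs (namely $u=0,v\ne0$); $q^m-q^{m-1}+\theta_1$ for exactly $m_1(q-1)$ pairs and $q^m-q^{m-1}+\theta_2$ for exactly $m_2(q-1)$ pairs (these being the pairs with $u\neq0$, $v\neq0$).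
   Context: $\mathrm{Tr}=\mathrm{Tr}_{\mathbb{F}_{q^m}/\mathbb{F}_q}$. $D$ is $\mathbb{F}_q^*$-invariant if $\lambda D=D$ for all $\lambda\in\mathbb{F}_q^*$. A strongly regular graph $(v,k,\lambda,\mu)$ is a simple undirected graph, neither complete nor edgeless, that is $k$-regular on $v$ vertices, where adjacent vertices have exactly $\lambda$ and nonadjacent vertices exactly $\mu$ common neighbours. For $D\subseteq\mathbb{F}_{q^m}^*$ with $-D=D$, $\mathrm{Cay}(\mathbb{F}_{q^m},D)$ has vertex set $\mathbb{F}_{q^m}$ and $x\sim y$ iff $x-y\in D$; $D$ is a partial difference set with parameters $(v,k,\lambda,\mu)$ if this graph is strongly regular with these parameters ($k=|D|$). Restricted eigenvalues are the adjacency eigenvalues having an eigenvector orthogonal to the all-one vector; there are exactly two, $\theta_1>0>\theta_2$, and their multiplicities are their multiplicities as eigenvalues of the adjacency matrix. Code: fix an ordering $x_1,\dots,x_{q^m-1}$ of $\mathbb{F}_{q^m}^*$, let $f_D$ be the characteristic function of $D$ ($1$ on $D$, $0$ off $D$), and for $(u,v)\in\mathbb{F}_q\times\mathbb{F}_{q^m}$ let $c(u,v)=(uf_D(x_i)+\mathrm{Tr}(vx_i))_{1\le i\le q^m-1}$; $\mathcal C(M_D)=\{c(u,v)\}$. The Hamming weight is the number of nonzero coordinates.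
   Formalization: If θ1 = k (disconnected graph) the stated count m1(q-1) is false (e.g. q=2, m=2, D={1}) and is replaced by (m1-1)(q-1); since weights of different classes may coincide, the counts for nonzero weights are taken within the named classes of pairs (u,v). *)

theory Defs
  imports "HOL-Analysis.Analysis" "HOL-Number_Theory.Prime_Powers"
begin

definition is_subfield :: "'a::field set \<Rightarrow> bool" where
  "is_subfield K \<longleftrightarrow>
     0 \<in> K \<and> 1 \<in> K \<and>
     (\<forall>x\<in>K. \<forall>y\<in>K. x + y \<in> K \<and> x * y \<in> K) \<and>
     (\<forall>x\<in>K. - x \<in> K \<and> inverse x \<in> K)"

text \<open>The trace from the field with \<open>q ^ m\<close> elements to its subfield with \<open>q\<close> elements,
  as the sum of the conjugates. Its values lie in that subfield, regarded inside the big field.\<close>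

definition field_trace :: "nat \<Rightarrow> nat \<Rightarrow> 'a::field \<Rightarrow> 'a" where
  "field_trace q m x = (\<Sum>i<m. x ^ (q ^ i))"

text \<open>Graphs have a whole finite type as vertex set and are given by their adjacency relation.\<close>

definition strongly_regular ::
  "('v::finite \<Rightarrow> 'v \<Rightarrow> bool) \<Rightarrow> nat \<Rightarrow> nat \<Rightarrow> nat \<Rightarrow> nat \<Rightarrow> bool" where
  "strongly_regular adj v k l \<mu> \<longleftrightarrow>
     (\<forall>x. \<not> adj x x) \<and> (\<forall>x y. adj x y \<longrightarrow> adj y x) \<and>
     (\<exists>x y. adj x y) \<and> (\<exists>x y. x \<noteq> y \<and> \<not> adj x y) \<and>
     CARD('v) = v \<and>
     (\<forall>x. card {y. adj x y} = k) \<and>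
     (\<forall>x y. adj x y \<longrightarrow> card {z. adj x z \<and> adj y z} = l) \<and>
     (\<forall>x y. x \<noteq> y \<and> \<not> adj x y \<longrightarrow> card {z. adj x z \<and> adj y z} = \<mu>)"

definition cayley :: "'a::ab_group_add set \<Rightarrow> 'a \<Rightarrow> 'a \<Rightarrow> bool" where
  "cayley D x y \<longleftrightarrow> x - y \<in> D"

definition partial_difference_set ::
  "'a::{ab_group_add,finite} set \<Rightarrow> nat \<Rightarrow> nat \<Rightarrow> nat \<Rightarrow> nat \<Rightarrow> bool" where
  "partial_difference_set D v k l \<mu> \<longleftrightarrow>
     0 \<notin> D \<and> uminus ` D = D \<and> strongly_regular (cayley D) v k l \<mu>"

definition adjacency_matrix :: "('v::finite \<Rightarrow> 'v \<Rightarrow> bool) \<Rightarrow> real ^ 'v ^ 'v" where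
  "adjacency_matrix adj = (\<chi> x y. of_bool (adj x y))"

definition eigenspace :: "real ^ 'v ^ 'v \<Rightarrow> real \<Rightarrow> (real ^ 'v) set" where
  "eigenspace A \<theta> = {w. A *v w = \<theta> *\<^sub>R w}"

text \<open>Adjacency matrices are real symmetric, so geometric and algebraic multiplicities agree.
  If the valency \<open>k\<close> is itself a restricted eigenvalue (a disconnected graph), its multiplicity also
  counts the all-one eigenvector and exceeds the one on the orthogonal complement of that vector by 1.\<close>

definition eigenvalue_multiplicity :: "real ^ 'v ^ 'v \<Rightarrow> real \<Rightarrow> nat" where
  "eigenvalue_multiplicity A \<theta> = dim (eigenspace A \<theta>)"

definition restricted_eigenvalue :: "('v::finite \<Rightarrow> 'v \<Rightarrow> bool) \<Rightarrow> real \<Rightarrow> bool" where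
  "restricted_eigenvalue adj \<theta> \<longleftrightarrow>
     (\<exists>w \<in> eigenspace (adjacency_matrix adj) \<theta>. w \<noteq> 0 \<and> w \<bullet> vec 1 = 0)"

text \<open>The list \<open>xs\<close> is the chosen ordering of the nonzero field elements; \<open>u\<close> is meant to range
  over the subfield with \<open>q\<close> elements.\<close>

definition codeword :: "nat \<Rightarrow> nat \<Rightarrow> 'a::field set \<Rightarrow> 'a list \<Rightarrow> 'a \<Rightarrow> 'a \<Rightarrow> 'a list" where
  "codeword q m D xs u v = map (\<lambda>x. u * of_bool (x \<in> D) + field_trace q m (v * x)) xs"

definition hamming_weight :: "'a::zero list \<Rightarrow> nat" where
  "hamming_weight c = card {i. i < length c \<and> c ! i \<noteq> 0}"

end

theory Submission
  imports Defs
begin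

text \<open>For \<open>u, v \<noteq> 0\<close>, the \<open>K\<close>-invariance of \<open>D\<close> turns the number of zeros of a codeword into a
  character sum, so that its weight is \<open>q ^ m - q ^ (m - 1) + \<chi> v\<close>, where \<open>\<chi> v\<close> is the number of
  \<open>d \<in> D\<close> with \<open>Tr (v d) = 0\<close> minus the number of those with \<open>Tr (v d) = 1\<close>. Complex characters are
  avoided: the centred indicators of the hyperplanes \<open>Tr (v x) = 1\<close>, \<open>v\<close> ranging over the whole
  field, are real eigenvectors of the Cayley graph for the eigenvalues \<open>\<chi> v\<close>. They span the whole
  space and are therefore a basis, so the multiplicity of \<open>\<theta>\<close> is the number of \<open>v\<close> with \<open>\<chi> v = \<theta>\<close>.
  Strong regularity makes every restricted eigenvalue a root of one quadratic, which leaves only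
  \<open>\<theta>1\<close> and \<open>\<theta>2\<close> as values of \<open>\<chi> v\<close> for \<open>v \<noteq> 0\<close>.\<close>

section \<open>General facts on finite subfields, strongly regular graphs, eigenbases and
  weights\<close>

lemma subfield_power_card:
  fixes K :: "'a::field set"
  assumes "is_subfield K" "finite K" "x \<in> K"
  shows "x ^ card K = x"
proof (cases "x = 0")
  case True
  then show ?thesis using assms by (auto simp: power_0_left)
next
  case False
  have "0 \<in> K" using assms unfolding is_subfield_def by blast
  then have cK: "Suc (card (K - {0})) = card K" by (rule card_Suc_Diff1[OF assms(2)])
  \<comment> \<open>Multiplication by \<open>x\<close> permutes the nonzero elements of
    \<open>K\<close>; cancelling their product leaves a power of \<open>x\<close> equal to
    \<open>1\<close>.\<close>
  have "(\<Prod>y\<in>K-{0}. x * y) = (\<Prod>y\<in>K-{0}. y)"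
    using False assms unfolding is_subfield_def
    by (intro prod.reindex_bij_witness[of _ "\<lambda>y. y / x" "\<lambda>y. x * y"])
       (auto simp: divide_inverse)
  then have "x ^ card (K - {0}) * (\<Prod>y\<in>K-{0}. y) = (\<Prod>y\<in>K-{0}. y)"
    by (simp add: prod.distrib)
  then have "x ^ card (K - {0}) = 1" using assms(2) by simp
  then have "x ^ Suc (card (K - {0})) = x" by simp
  then show ?thesis using cK by simp
qed

lemma card_eq_sum_of_bool: "finite A \<Longrightarrow> real (card {x\<in>A. P x}) = (\<Sum>x\<in>A. of_bool (P x))"
  by (simp add: Collect_conj_eq)

text \<open>Counting walks of length two gives
  \<open>A^2 = (k - \<mu>) I + (l - \<mu>) A + \<mu> J\<close> for the adjacency matrix
  \<open>A\<close>. On an eigenvector orthogonal to the constants the all-one matrix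
  \<open>J\<close> vanishes.\<close>

lemma strongly_regular_restricted_eigenvalue:
  fixes adj :: "'v::finite \<Rightarrow> 'v \<Rightarrow> bool"
  assumes srg: "strongly_regular adj v k l \<mu>" and "restricted_eigenvalue adj \<theta>"
  shows "\<theta>\<^sup>2 = (real l - real \<mu>) * \<theta> + (real k - real \<mu>)"
proof -
  obtain w where w: "adjacency_matrix adj *v w = \<theta> *\<^sub>R w" "w \<noteq> 0" "w \<bullet> vec 1 = 0"
    using assms(2) unfolding restricted_eigenvalue_def eigenspace_def by auto
  have ev: "(\<Sum>y\<in>UNIV. of_bool (adj x y) * w $ y) = \<theta> * w $ x" for x
    using arg_cong[OF w(1), of "\<lambda>u. u $ x"]
    by (simp add: adjacency_matrix_def matrix_vector_mult_def)
  have orth: "(\<Sum>y\<in>UNIV. w $ y) = 0"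
    using w(3) by (simp add: inner_vec_def)
  obtain x where x: "w $ x \<noteq> 0"
    using w(2) by (auto simp: vec_eq_iff)
  have common: "(\<Sum>y\<in>UNIV. of_bool (adj x y) * of_bool (adj y z)) =
      (real k - real \<mu>) * of_bool (z = x) + (real l - real \<mu>) * of_bool (adj x z) + real \<mu>" for z
  proof -
    have sym: "adj a b \<longleftrightarrow> adj b a" for a b
      using srg unfolding strongly_regular_def by blast
    have "(\<Sum>y\<in>UNIV. of_bool (adj x y) * of_bool (adj y z)) = real (card {y. adj x y \<and> adj z y})"
      using card_eq_sum_of_bool[of UNIV "\<lambda>y. adj x y \<and> adj z y"] sym[of z]
      by (simp add: of_bool_conj)
    then show ?thesis
      using srg unfolding strongly_regular_def by (cases "z = x"; cases "adj x z") auto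
  qed
  have "\<theta> * (\<theta> * w $ x) = (\<Sum>y\<in>UNIV. of_bool (adj x y) * (\<theta> * w $ y))"
    unfolding ev[of x, symmetric] sum_distrib_left by (simp add: mult.left_commute)
  also have "\<dots> = (\<Sum>y\<in>UNIV. \<Sum>z\<in>UNIV. of_bool (adj x y) * of_bool (adj y z) * w $ z)"
    unfolding ev[symmetric] sum_distrib_left by (simp add: mult.assoc)
  also have "\<dots> = (\<Sum>z\<in>UNIV. (\<Sum>y\<in>UNIV. of_bool (adj x y) * of_bool (adj y z)) * w $ z)"
    unfolding sum_distrib_right by (rule sum.swap)
  also have "\<dots> = (\<Sum>z\<in>UNIV. (real k - real \<mu>) * (of_bool (z = x) * w $ z))
      + (\<Sum>z\<in>UNIV. (real l - real \<mu>) * (of_bool (adj x z) * w $ z)) + (\<Sum>z\<in>UNIV. real \<mu> * w $ z)"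
    unfolding common by (simp add: distrib_right sum.distrib mult.assoc)
  also have "\<dots> = (real k - real \<mu>) * w $ x + (real l - real \<mu>) * (\<theta> * w $ x)"
    unfolding sum_distrib_left[symmetric] ev orth by simp
  finally have "w $ x * \<theta>\<^sup>2 = w $ x * ((real l - real \<mu>) * \<theta> + (real k - real \<mu>))"
    by (simp add: algebra_simps power2_eq_square)
  then show ?thesis using x by simp
qed

text \<open>A spanning family no larger than the dimension is a basis, without repetitions.
  Comparing the coordinates of \<open>A *v w\<close> and \<open>\<theta> *\<^sub>R w\<close> kills
  every coefficient of \<open>w\<close> whose \<open>e i\<close> differs from
  \<open>\<theta>\<close>.\<close>

lemma eigenspace_dim_of_eigenbasis:
  fixes A :: "real ^ 'n ^ 'n" and f :: "'i::finite \<Rightarrow> real ^ 'n"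
  assumes span: "span (range f) = UNIV" and card: "CARD('i) = CARD('n)"
    and ev: "\<And>i. A *v f i = e i *\<^sub>R f i"
  shows "inj f" and "independent (range f)"
    and "dim (eigenspace A \<theta>) = card {i. e i = \<theta>}"
proof -
  have le: "card (range f) \<le> CARD('n)"
    using card_image_le[of UNIV f] card by simp
  show ind: "independent (range f)"
    by (rule card_le_dim_spanning[where V = UNIV]) (use span le in auto)
  have "card (range f) = CARD('i)"
    using basis_card_eq_dim[of "range f" UNIV] span ind card by simp
  then show inj: "inj f"
    by (intro eq_card_imp_inj_on) auto
  define S where "S = {i. e i = \<theta>}"
  have "eigenspace A \<theta> \<subseteq> span (f ` S)"
  proof
    fix w assume "w \<in> eigenspace A \<theta>"
    then have w: "A *v w = \<theta> *\<^sub>R w" by (simp add: eigenspace_def)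
    obtain a where "w = (\<Sum>b\<in>range f. a b *\<^sub>R b)"
      using span by (auto simp: span_finite)
    then have wa: "w = (\<Sum>i\<in>UNIV. a (f i) *\<^sub>R f i)"
      by (simp add: sum.reindex[OF inj])
    have "A *v w = (\<Sum>i\<in>UNIV. (a (f i) * e i) *\<^sub>R f i)"
      unfolding wa by (simp add: linear_sum[OF matrix_vector_mul_linear] ev matrix_vector_mult_scaleR)
    then have "(\<Sum>i\<in>UNIV. (a (f i) * (e i - \<theta>)) *\<^sub>R f i) = 0"
      using w unfolding wa by (simp add: algebra_simps scaleR_sum_right sum_subtractf)
    \<comment> \<open>Independence is a property of the set \<open>range f\<close>, so the
      coefficients are re-indexed by vectors through \<open>inv f\<close>.\<close>
    then have "(\<Sum>b\<in>range f. (a b * (e (inv f b) - \<theta>)) *\<^sub>R b) = 0"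
      by (simp add: sum.reindex[OF inj] inv_f_f[OF inj])
    then have "a (f i) * (e (inv f (f i)) - \<theta>) = 0" for i
      using independentD[OF ind, of "range f" "\<lambda>b. a b * (e (inv f b) - \<theta>)" "f i"] by auto
    then have "a (f i) = 0" if "i \<notin> S" for i
      using that by (auto simp: S_def inv_f_f[OF inj])
    then have "w = (\<Sum>i\<in>S. a (f i) *\<^sub>R f i)"
      unfolding wa by (intro sum.mono_neutral_right) auto
    then show "w \<in> span (f ` S)"
      by (simp add: span_sum span_scale span_base)
  qed
  moreover have "f ` S \<subseteq> eigenspace A \<theta>"
    using ev by (auto simp: S_def eigenspace_def)
  ultimately have "card (f ` S) = dim (eigenspace A \<theta>)"
    using independent_mono[OF ind, of "f ` S"] by (intro basis_card_eq_dim) auto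
  then show "dim (eigenspace A \<theta>) = card {i. e i = \<theta>}"
    using card_image[OF inj_on_subset[OF inj, of S]] by (simp add: S_def)
qed

lemma hamming_weight_map:
  assumes "distinct xs"
  shows "hamming_weight (map g xs) = card {x \<in> set xs. g x \<noteq> 0}"
proof -
  have "{x \<in> set xs. g x \<noteq> 0} = (!) xs ` {i. i < length xs \<and> g (xs ! i) \<noteq> 0}"
    by (auto simp: set_conv_nth)
  moreover have "inj_on ((!) xs) {i. i < length xs \<and> g (xs ! i) \<noteq> 0}"
    using assms by (auto simp: inj_on_def nth_eq_iff_index_eq)
  ultimately have "card {x \<in> set xs. g x \<noteq> 0} = card {i. i < length xs \<and> g (xs ! i) \<noteq> 0}"
    by (simp add: card_image)
  also have "{i. i < length xs \<and> g (xs ! i) \<noteq> 0} =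
      {i. i < length (map g xs) \<and> map g xs ! i \<noteq> 0}" by auto
  finally show ?thesis unfolding hamming_weight_def by simp
qed

section \<open>The trace of a finite field extension\<close>

locale finite_extension =
  fixes K :: "'a::{field,finite} set" and q m :: nat
  assumes q: "primepow q" and m: "m > 0" and card_UNIV: "CARD('a) = q ^ m"
    and K: "is_subfield K" and card_K: "card K = q"
begin

abbreviation "T \<equiv> field_trace q m"

lemma K_simps [simp, intro]:
  "0 \<in> K" "1 \<in> K" "x \<in> K \<Longrightarrow> y \<in> K \<Longrightarrow> x + y \<in> K" "x \<in> K \<Longrightarrow> y \<in> K \<Longrightarrow> x * y \<in> K"
  "x \<in> K \<Longrightarrow> - x \<in> K" "x \<in> K \<Longrightarrow> inverse x \<in> K"
  "x \<in> K \<Longrightarrow> y \<in> K \<Longrightarrow> x - y \<in> K" "x \<in> K \<Longrightarrow> y \<in> K \<Longrightarrow> x / y \<in> K"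
  using K unfolding is_subfield_def diff_conv_add_uminus divide_inverse by blast+

lemma q_gt_1: "q > 1"
  using q primepow_gt_Suc_0 by auto

lemma q_power_m: "q ^ m = q * q ^ (m - 1)"
  using power_minus_mult[OF m, of q] by (simp add: mult.commute)

text \<open>Through the freshman's dream this makes every \<open>q ^ i\<close>-th power map
  additive.\<close>

lemma q_power_char: "\<exists>n. q ^ i = CHAR('a) ^ n" and prime_char: "prime CHAR('a)"
proof -
  show pc: "prime CHAR('a)"
    using prime_CHAR_semidom[where ?'a = 'a] finite_imp_CHAR_pos[where ?'a = 'a] by simp
  obtain p n where pn: "prime p" "q = p ^ n"
    using q unfolding primepow_def by blast
  \<comment> \<open>The shift by \<open>1\<close> permutes the field, so the two sums agree and
    their difference, \<open>CARD('a)\<close> times \<open>1\<close>, is zero.\<close>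
  have "(\<Sum>x\<in>UNIV. x + 1 :: 'a) = (\<Sum>x\<in>UNIV. x)"
    by (rule sum.reindex_bij_witness[of _ "\<lambda>x. x - 1" "\<lambda>x. x + 1"]) auto
  then have "of_nat (CARD('a)) = (0 :: 'a)" by (simp add: sum.distrib)
  then have "CHAR('a) dvd p ^ (n * m)"
    using card_UNIV pn(2) by (metis of_nat_eq_0_iff_char_dvd power_mult)
  then have "CHAR('a) = p"
    using pc pn(1) prime_dvd_power primes_dvd_imp_eq by blast
  then show "\<exists>n. q ^ i = CHAR('a) ^ n"
    using pn by (auto simp flip: power_mult)
qed

lemma power_q_add: "(x + y :: 'a) ^ (q ^ i) = x ^ (q ^ i) + y ^ (q ^ i)"
  using q_power_char[of i] freshmans_dream'[OF prime_char] by auto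

lemma power_q_sum: "(sum g A :: 'a) ^ q = (\<Sum>i\<in>A. g i ^ q)"
  using q_power_char[of 1] freshmans_dream_sum'[OF prime_char] by auto

lemma trace_add: "T (x + y :: 'a) = T x + T y"
  by (simp add: field_trace_def power_q_add sum.distrib)

lemma trace_0 [simp]: "T (0 :: 'a) = 0"
  by (metis add.right_neutral add_left_cancel trace_add)

lemma trace_diff: "T (x - y :: 'a) = T x - T y"
  using trace_add[of "x - y" y] by simp

lemma power_q_in_K:
  assumes "c \<in> K" shows "c ^ (q ^ i) = c"
proof (induction i)
  case (Suc i)
  have "c ^ (q ^ Suc i) = (c ^ (q ^ i)) ^ q"
    by (simp add: power_mult[symmetric] mult.commute)
  then show ?case using Suc subfield_power_card[OF K _ assms] card_K by simp
qed simp

lemma trace_smult: "c \<in> K \<Longrightarrow> T (c * x) = c * T x"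
  by (simp add: field_trace_def power_mult_distrib power_q_in_K sum_distrib_left)

text \<open>The polynomial \<open>X^q - X\<close> has at most \<open>q\<close> roots, and the
  \<open>q\<close> elements of \<open>K\<close> are already roots.\<close>

lemma fixed_power_q_in_K:
  assumes "(x :: 'a) ^ q = x" shows "x \<in> K"
proof -
  define P :: "'a poly" where "P = monom 1 q - monom 1 1"
  have "coeff P q = 1" using q_gt_1 by (simp add: P_def)
  then have "P \<noteq> 0" by auto
  have "degree P \<le> q" unfolding P_def using q_gt_1
    by (intro degree_diff_le) (auto simp: degree_monom_eq)
  moreover have "K \<subseteq> {x. poly P x = 0}"
    using power_q_in_K[of _ 1] by (auto simp: P_def poly_monom)
  moreover have "card {x. poly P x = 0} \<le> degree P"
    by (rule card_poly_roots_bound[OF \<open>P \<noteq> 0\<close>])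
  ultimately have "K = {x. poly P x = 0}"
    using card_K by (intro card_seteq) auto
  then show ?thesis using assms by (auto simp: P_def poly_monom)
qed

text \<open>Raising to the power \<open>q\<close> permutes the conjugates cyclically, since
  \<open>x ^ (q ^ m) = x\<close>.\<close>

lemma trace_in_K [simp]: "T (x :: 'a) \<in> K"
proof (rule fixed_power_q_in_K)
  have "is_subfield (UNIV :: 'a set)" by (simp add: is_subfield_def)
  then have xq: "x ^ (q ^ m) = x"
    using subfield_power_card[of UNIV x] card_UNIV by simp
  have "T x ^ q = (\<Sum>i<m. x ^ (q ^ Suc i))"
    by (simp add: field_trace_def power_q_sum power_mult[symmetric] mult.commute)
  also have "\<dots> = (\<Sum>i<m. x ^ (q ^ i))"
    using sum.lessThan_Suc_shift[of "\<lambda>i. x ^ (q ^ i)" m] sum.lessThan_Suc[of "\<lambda>i. x ^ (q ^ i)" m] xq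
    by simp
  finally show "T x ^ q = T x" by (simp add: field_trace_def)
qed

text \<open>The trace is a nonzero polynomial function of degree at most \<open>q ^ (m - 1)\<close>,
  too small to vanish at all \<open>q ^ m\<close> points.\<close>

lemma trace_nonzero: "\<exists>x :: 'a. T x \<noteq> 0"
proof (rule ccontr)
  assume "\<not> ?thesis"
  then have all: "T (x :: 'a) = 0" for x by blast
  define P :: "'a poly" where "P = (\<Sum>i<m. monom 1 (q ^ i))"
  have "coeff P (q ^ (m - 1)) = (\<Sum>i<m. of_bool (i = m - 1))"
    unfolding P_def coeff_sum using q_gt_1 by (intro sum.cong) auto
  also have "\<dots> = 1" using m by (simp add: sum.delta' of_bool_def)
  finally have "P \<noteq> 0" by auto
  have "degree P \<le> q ^ (m - 1)" unfolding P_def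
    using q_gt_1 by (intro degree_sum_le) (auto simp: degree_monom_eq intro!: power_increasing)
  moreover have "{x. poly P x = 0} = UNIV"
    using all by (auto simp: P_def poly_sum poly_monom field_trace_def)
  ultimately have "q ^ m \<le> q ^ (m - 1)"
    using card_poly_roots_bound[OF \<open>P \<noteq> 0\<close>] card_UNIV by simp
  then show False using q_gt_1 m by simp
qed

lemma trace_surj:
  assumes "v \<noteq> 0" "c \<in> K" shows "\<exists>x. T (v * x :: 'a) = c"
proof -
  obtain y :: 'a where y: "T y \<noteq> 0" using trace_nonzero by blast
  have "T (v * (c / T y * y / v)) = T (c / T y * y)" using assms by simp
  also have "\<dots> = c" using y assms by (subst trace_smult) auto
  finally show ?thesis by blast
qed

text \<open>All fibres over \<open>K\<close> are translates of the kernel, and these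
  \<open>q\<close> fibres partition the field.\<close>

lemma card_trace_fibre:
  assumes "v \<noteq> 0" "c \<in> K" shows "card {x. T (v * x :: 'a) = c} = q ^ (m - 1)"
proof -
  have eq: "card {x. T (v * x) = d} = card {x. T (v * x) = 0}" if d: "d \<in> K" for d
  proof -
    obtain y where "T (v * y) = d" using trace_surj assms(1) d by blast
    then show ?thesis
      by (intro bij_betw_same_card[of "\<lambda>x. x - y"] bij_betwI[where g = "\<lambda>x. x + y"])
         (auto simp: trace_diff trace_add right_diff_distrib distrib_left)
  qed
  have "q * q ^ (m - 1) = card (\<Union>d\<in>K. {x. T (v * x) = d})"
  proof -
    have "(\<Union>d\<in>K. {x. T (v * x) = d}) = UNIV" by auto
    then show ?thesis using card_UNIV q_power_m by simp
  qed
  also have "\<dots> = (\<Sum>d\<in>K. card {x. T (v * x) = d})"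
    by (rule card_UN_disjoint) auto
  also have "\<dots> = (\<Sum>d\<in>K. card {x. T (v * x) = 0})"
    by (intro sum.cong refl eq)
  also have "\<dots> = q * card {x. T (v * x) = 0}"
    using card_K by simp
  finally show ?thesis using q_gt_1 by (simp add: eq[OF assms(2)])
qed

section \<open>Centred hyperplane indicators as a spanning family\<close>

text \<open>A real substitute for the additive characters: for \<open>v \<noteq> 0\<close> it is the indicator of the
  affine hyperplane \<open>T (v x) = 1\<close> projected orthogonally to the constants; for \<open>v = 0\<close> it is a
  nonzero constant vector.\<close>

definition plane_vec :: "'a \<Rightarrow> (real, 'a) vec" where
  "plane_vec v = (\<chi> x. of_bool (T (v * x) = 1) - 1 / q)"

lemma plane_vec_orthogonal: "v \<noteq> 0 \<Longrightarrow> plane_vec v \<bullet> vec 1 = 0"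
  using card_trace_fibre[of v 1] card_eq_sum_of_bool[of UNIV "\<lambda>x. T (v * x) = 1"]
    card_UNIV q_power_m q_gt_1
  by (simp add: plane_vec_def inner_vec_def sum_subtractf)

lemma const_in_span: "vec c \<in> span (range plane_vec)"
proof -
  have "vec c = (- c * q) *\<^sub>R plane_vec 0"
    using q_gt_1 by (simp add: plane_vec_def vec_eq_iff)
  then show ?thesis by (metis rangeI span_base span_scale)
qed

text \<open>For \<open>c\<close> nonzero, level \<open>c\<close> of \<open>v\<close> is level
  \<open>1\<close> of \<open>v / c\<close>, hence a \<open>plane_vec\<close> plus a constant. Level
  \<open>0\<close> is the complement of all the other levels.\<close>

lemma affine_plane_in_span:
  assumes "v \<noteq> 0" "c \<in> K"
  shows "(\<chi> x. of_bool (T (v * x) = c)) \<in> span (range plane_vec)"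
proof -
  have nz: "(\<chi> x. of_bool (T (v * x) = c)) \<in> span (range plane_vec)" if "c \<in> K" "c \<noteq> 0" for c
  proof -
    have "T (v / c * x) = T (v * x) / c" for x
      using that trace_smult[of "inverse c" "v * x"] by (simp add: field_simps)
    then have "(\<chi> x. of_bool (T (v * x) = c)) = plane_vec (v / c) + vec (1 / q)"
      using that by (auto simp: plane_vec_def vec_eq_iff)
    then show ?thesis by (simp add: span_add const_in_span span_base)
  qed
  show ?thesis
  proof (cases "c = 0")
    case True
    have "of_bool (T (v * x) = 0) = 1 - (\<Sum>c\<in>K-{0}. of_bool (T (v * x) = c) :: real)" for x
    proof -
      have "(\<Sum>c\<in>K. of_bool (T (v * x) = c) :: real) = 1"
        by (simp add: of_bool_def)
      then show ?thesis by (simp add: sum.remove[of K 0])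
    qed
    then have eq: "(\<chi> x. of_bool (T (v * x) = c)) =
        vec 1 - (\<Sum>c\<in>K-{0}. (\<chi> x. of_bool (T (v * x) = c) :: (real, 'a) vec))"
      using True by (simp add: vec_eq_iff)
    then show ?thesis by (simp only:) (intro span_diff span_sum const_in_span nz; simp)
  qed (use nz assms in auto)
qed

text \<open>The point mass at \<open>y\<close> is recovered from all the planes \<open>T (v (x - y)) = 1\<close>: they miss \<open>y\<close>, and
  every other point lies on exactly \<open>q ^ (m - 1)\<close> of them.\<close>

lemma span_plane_vec: "span (range plane_vec) = UNIV"
proof -
  have ax: "axis y 1 \<in> span (range plane_vec)" for y
  proof -
    have "(\<Sum>v\<in>UNIV-{0}. of_bool (T (v * x) = 1 + T (v * y))) = real (q ^ (m - 1)) * of_bool (x \<noteq> y)" for x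
    proof -
      \<comment> \<open>As a condition on \<open>v\<close> this is again a trace fibre, now with
        multiplier \<open>x - y\<close>; the term \<open>v = 0\<close> can be added because
        \<open>T 0\<close> is not \<open>1\<close>.\<close>
      have "(\<Sum>v\<in>UNIV-{0}. of_bool (T (v * x) = 1 + T (v * y)) :: real)
          = (\<Sum>v\<in>UNIV-{0}. of_bool (T ((x - y) * v) = 1))"
        by (intro sum.cong refl arg_cong[of _ _ of_bool])
           (auto simp: left_diff_distrib trace_diff mult.commute algebra_simps)
      also have "\<dots> = (\<Sum>v\<in>UNIV. of_bool (T ((x - y) * v) = 1))"
        by (rule sum.mono_neutral_left) auto
      also have "\<dots> = real (card {v. T ((x - y) * v) = 1})"
        using card_eq_sum_of_bool[of UNIV "\<lambda>v. T ((x - y) * v) = 1"] by simp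
      also have "\<dots> = real (q ^ (m - 1)) * of_bool (x \<noteq> y)"
        using card_trace_fibre[of "x - y" 1] by (cases "x = y") auto
      finally show ?thesis .
    qed
    then have eq: "axis y (1::real) = vec 1 - (1 / real (q ^ (m - 1))) *\<^sub>R
        (\<Sum>v\<in>UNIV-{0}. (\<chi> x. of_bool (T (v * x) = 1 + T (v * y))))"
      using q_gt_1 by (simp add: vec_eq_iff axis_def)
    show ?thesis
      unfolding eq by (intro span_diff span_scale span_sum const_in_span affine_plane_in_span) auto
  qed
  have "w \<in> span (range plane_vec)" for w
  proof -
    have "(\<Sum>y\<in>UNIV. (w $ y) *\<^sub>R axis y 1) \<in> span (range plane_vec)"
      by (intro span_sum span_scale ax)
    then show ?thesis
      using basis_expansion[of w] by (simp add: scalar_mult_eq_scaleR)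
  qed
  then show ?thesis by blast
qed

end

section \<open>Character values and codeword weights for an invariant set\<close>

locale invariant_set = finite_extension K q m for K :: "'a::{field,finite} set" and q m +
  fixes D :: "'a set"
  assumes D_smult: "c \<in> K \<Longrightarrow> c \<noteq> 0 \<Longrightarrow> (\<lambda>x. c * x) ` D = D"
begin

text \<open>The value at \<open>D\<close> of the additive character belonging to \<open>v\<close>.\<close>

definition chi :: "'a \<Rightarrow> real" where
  "chi v = real (card {d\<in>D. T (v * d) = 0}) - real (card {d\<in>D. T (v * d) = 1})"

text \<open>By invariance, multiplication by \<open>c\<close> maps \<open>D\<close> onto itself and
  carries level \<open>1\<close> to level \<open>c\<close>.\<close>

lemma card_trace_level:
  assumes "c \<in> K" "c \<noteq> 0"
  shows "card {d\<in>D. T (v * d) = c} = card {d\<in>D. T (v * d) = 1}"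
proof -
  have *: "a * d \<in> D" if "a \<in> K" "a \<noteq> 0" "d \<in> D" for a d
    using D_smult[OF that(1,2)] that(3) by blast
  have "T (v * (c * d)) = c * T (v * d)" "T (v * (inverse c * d)) = inverse c * T (v * d)" for d
    using trace_smult[of c "v * d"] trace_smult[of "inverse c" "v * d"] assms
    by (auto simp: mult_ac)
  then have "bij_betw (\<lambda>d. c * d) {d\<in>D. T (v * d) = 1} {d\<in>D. T (v * d) = c}"
    using assms *[of c] *[of "inverse c"]
    by (intro bij_betwI[where g = "\<lambda>d. inverse c * d"]) auto
  then show ?thesis by (simp add: bij_betw_same_card)
qed

lemma card_D_eq: "real (card D) =
    real (card {d\<in>D. T (v * d) = 0}) + (real q - 1) * real (card {d\<in>D. T (v * d) = 1})"
proof -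
  have "D = (\<Union>c\<in>K. {d\<in>D. T (v * d) = c})" by auto
  then have "card D = (\<Sum>c\<in>K. card {d\<in>D. T (v * d) = c})"
    by (subst (1) \<open>D = _\<close>, intro card_UN_disjoint) auto
  also have "\<dots> = card {d\<in>D. T (v * d) = 0} + (\<Sum>c\<in>K-{0}. card {d\<in>D. T (v * d) = 1})"
  proof -
    have "(\<Sum>c\<in>K-{0}. card {d\<in>D. T (v * d) = c}) = (\<Sum>c\<in>K-{0}. card {d\<in>D. T (v * d) = 1})"
      by (intro sum.cong refl card_trace_level) auto
    then show ?thesis by (simp add: sum.remove[of K 0])
  qed
  also have "\<dots> = card {d\<in>D. T (v * d) = 0} + (q - 1) * card {d\<in>D. T (v * d) = 1}"
    by (simp add: card_K)
  finally show ?thesis using q_gt_1 by (simp add: of_nat_diff)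
qed

lemma chi_0: "chi 0 = card D"
  by (simp add: chi_def)

text \<open>Let \<open>N0\<close> and \<open>N1\<close> count the points of \<open>D\<close> at
  levels \<open>0\<close> and \<open>1\<close>. The neighbours of \<open>x\<close> on the plane
  number \<open>N0\<close> if \<open>T (v * x) = 1\<close> and \<open>N1\<close> otherwise.
  Subtracting \<open>card D / q\<close>, where \<open>card D = N0 + (q - 1) N1\<close>, leaves
  \<open>N0 - N1\<close> times the entry at \<open>x\<close>.\<close>

lemma plane_vec_eigenvector:
  "adjacency_matrix (cayley D) *v plane_vec v = chi v *\<^sub>R plane_vec v"
proof -
  have "(adjacency_matrix (cayley D) *v plane_vec v) $ x = (chi v *\<^sub>R plane_vec v) $ x" for x
  proof -
    have "(adjacency_matrix (cayley D) *v plane_vec v) $ x =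
        (\<Sum>y\<in>UNIV. of_bool (x - y \<in> D) * (of_bool (T (v * y) = 1) - 1 / q))"
      by (simp add: adjacency_matrix_def matrix_vector_mult_def cayley_def plane_vec_def)
    also have "\<dots> = (\<Sum>d\<in>UNIV. of_bool (d \<in> D) * (of_bool (T (v * (x - d)) = 1) - 1 / q))"
      by (rule sum.reindex_bij_witness[of _ "\<lambda>d. x - d" "\<lambda>y. x - y"]) auto
    also have "\<dots> = (\<Sum>d\<in>D. of_bool (T (v * (x - d)) = 1) - 1 / q)"
      by (intro sum.mono_neutral_cong_right) auto
    also have "\<dots> = real (card {d\<in>D. T (v * d) = T (v * x) - 1}) - card D / q"
      using card_eq_sum_of_bool[of D "\<lambda>d. T (v * d) = T (v * x) - 1"]
      by (simp add: sum_subtractf right_diff_distrib trace_diff algebra_simps eq_commute)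
    also have "\<dots> = chi v * (of_bool (T (v * x) = 1) - 1 / q)"
      using card_trace_level[of "T (v * x) - 1" v] q_gt_1
      by (cases "T (v * x) = 1") (auto simp: card_D_eq[of v] chi_def field_simps)
    finally show ?thesis by (simp add: plane_vec_def)
  qed
  then show ?thesis by (simp add: vec_eq_iff)
qed

lemmas plane_vec_basis =
  eigenspace_dim_of_eigenbasis[OF span_plane_vec refl plane_vec_eigenvector]

lemma multiplicity_eq: "eigenvalue_multiplicity (adjacency_matrix (cayley D)) \<theta> = card {v. chi v = \<theta>}"
  unfolding eigenvalue_multiplicity_def by (rule plane_vec_basis(3))

lemma restricted_eigenvalue_chi:
  assumes "v \<noteq> 0" shows "restricted_eigenvalue (cayley D) (chi v)"
proof -
  have "plane_vec v \<noteq> 0"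
    using plane_vec_basis(2) dependent_zero by (metis rangeI)
  then show ?thesis
    unfolding restricted_eigenvalue_def eigenspace_def
    using plane_vec_eigenvector plane_vec_orthogonal[OF assms] by blast
qed

text \<open>Zeros off \<open>D\<close> lie at trace level \<open>0\<close>, zeros in
  \<open>D\<close> at level \<open>-u\<close>, which holds as many points of \<open>D\<close> as
  level \<open>1\<close>. This gives \<open>q ^ (m - 1) - chi v\<close> zeros in all.\<close>

lemma card_codeword_support:
  assumes "u \<in> K" "u \<noteq> 0" "v \<noteq> 0"
  shows "real (card {x. u * of_bool (x \<in> D) + T (v * x) \<noteq> 0}) =
    real (q ^ m) - real (q ^ (m - 1)) + chi v"
proof -
  let ?Z = "{x. T (v * x) = 0} - {d\<in>D. T (v * d) = 0}" and ?M = "{d\<in>D. T (v * d) = - u}"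
  have "{x. u * of_bool (x \<in> D) + T (v * x) = 0} = ?Z \<union> ?M"
    by (auto simp: add_eq_0_iff)
  moreover have "card (?Z \<union> ?M) = card ?Z + card ?M"
    by (rule card_Un_disjoint) auto
  moreover have "real (card ?Z) = real (q ^ (m - 1)) - card {d\<in>D. T (v * d) = 0}"
  proof -
    have "card {d\<in>D. T (v * d) = 0} \<le> card {x. T (v * x) = 0}" by (intro card_mono) auto
    then show ?thesis
      using card_trace_fibre[OF assms(3), of 0] by (subst card_Diff_subset) (auto simp: of_nat_diff)
  qed
  moreover have "card ?M = card {d\<in>D. T (v * d) = 1}"
    using assms by (intro card_trace_level) auto
  moreover have "{x. u * of_bool (x \<in> D) + T (v * x) \<noteq> 0} = - {x. u * of_bool (x \<in> D) + T (v * x) = 0}"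
    by auto
  ultimately show ?thesis
    using card_UNIV card_mono[of UNIV "?Z \<union> ?M"] by (simp add: Compl_eq_Diff_UNIV card_Diff_subset of_nat_diff chi_def)
qed

end

section \<open>The weight distribution\<close>

theorem theorem4:
  fixes K D :: "'a::{field,finite} set"
    and xs :: "'a list"
    and q m k l \<mu> m1 m2 :: nat
    and \<theta>1 \<theta>2 :: real
    and wt :: "'a \<Rightarrow> 'a \<Rightarrow> nat"
  assumes "primepow q" and "m > 0"
    and "CARD('a) = q ^ m" and "is_subfield K" and "card K = q"
    and "D \<subseteq> UNIV - {0}"
    and "\<forall>c\<in>K - {0}. (\<lambda>x. c * x) ` D = D"
    and "partial_difference_set D (q ^ m) k l \<mu>"
    and "restricted_eigenvalue (cayley D) \<theta>1" and "\<theta>1 > 0"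
    and "restricted_eigenvalue (cayley D) \<theta>2" and "\<theta>2 < 0"
    and "m1 = eigenvalue_multiplicity (adjacency_matrix (cayley D)) \<theta>1"
    and "m2 = eigenvalue_multiplicity (adjacency_matrix (cayley D)) \<theta>2"
    and "distinct xs" and "set xs = UNIV - {0}"
    and "\<And>u v. wt u v = hamming_weight (codeword q m D xs u v)"
  shows
    "{(u, v). u \<in> K \<and> wt u v = 0} = {(0, 0)} \<and>
     (\<forall>u\<in>K - {0}. wt u 0 = k) \<and>
     card {(u, v). u \<in> K \<and> u \<noteq> 0 \<and> v = (0::'a)} = q - 1 \<and>
     (\<forall>v. v \<noteq> 0 \<longrightarrow> wt 0 v = q ^ m - q ^ (m - 1)) \<and>
     card {(u, v). u \<in> K \<and> u = 0 \<and> v \<noteq> (0::'a)} = q ^ m - 1 \<and>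
     (\<forall>u\<in>K - {0}. \<forall>v. v \<noteq> 0 \<longrightarrow>
        real (wt u v) = real (q ^ m) - real (q ^ (m - 1)) + \<theta>1 \<or>
        real (wt u v) = real (q ^ m) - real (q ^ (m - 1)) + \<theta>2) \<and>
     (\<theta>1 \<noteq> real k \<longrightarrow>
        card {(u, v). u \<in> K \<and> u \<noteq> 0 \<and> v \<noteq> 0 \<and>
          real (wt u v) = real (q ^ m) - real (q ^ (m - 1)) + \<theta>1} = m1 * (q - 1)) \<and>
     (\<theta>1 = real k \<longrightarrow>
        card {(u, v). u \<in> K \<and> u \<noteq> 0 \<and> v \<noteq> 0 \<and>
          real (wt u v) = real (q ^ m) - real (q ^ (m - 1)) + \<theta>1} = (m1 - 1) * (q - 1)) \<and>
     card {(u, v). u \<in> K \<and> u \<noteq> 0 \<and> v \<noteq> 0 \<and>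
       real (wt u v) = real (q ^ m) - real (q ^ (m - 1)) + \<theta>2} = m2 * (q - 1)"
proof -
  interpret invariant_set K q m D
    by standard (use assms(1-5,7) in auto)
  have srg: "strongly_regular (cayley D) (q ^ m) k l \<mu>" and D0: "0 \<notin> D"
    using assms(8) unfolding partial_difference_set_def by auto
  have k: "card D = k"
  proof -
    have "card {y. cayley D 0 y} = k"
      using srg unfolding strongly_regular_def by blast
    moreover have "card {y. cayley D 0 y} = card D"
      by (intro bij_betw_same_card[of uminus] bij_betwI[where g = uminus]) (auto simp: cayley_def)
    ultimately show ?thesis by simp
  qed
  have D_ne: "D \<noteq> {}"
    using srg unfolding strongly_regular_def cayley_def by blast
  then have k_pos: "k > 0" using k by (auto simp: card_gt_0_iff)
  have quad: "\<theta>\<^sup>2 = (real l - real \<mu>) * \<theta> + (real k - real \<mu>)"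
    if "restricted_eigenvalue (cayley D) \<theta>" for \<theta>
    using strongly_regular_restricted_eigenvalue[OF srg that] .
  have \<theta>_ne: "\<theta>1 \<noteq> \<theta>2" using assms(10,12) by simp
  \<comment> \<open>The two distinct roots determine the quadratic, so any further restricted
    eigenvalue must equal one of them.\<close>
  have vieta: "\<theta>1 + \<theta>2 = real l - real \<mu>" "\<theta>1 * \<theta>2 = real \<mu> - real k"
  proof -
    have "(\<theta>1 - \<theta>2) * (\<theta>1 + \<theta>2 - (real l - real \<mu>)) = 0"
      using quad[OF assms(9)] quad[OF assms(11)] by (simp add: algebra_simps power2_eq_square)
    then show sum: "\<theta>1 + \<theta>2 = real l - real \<mu>" using \<theta>_ne by simp
    show "\<theta>1 * \<theta>2 = real \<mu> - real k"
      using quad[OF assms(9)] unfolding sum[symmetric] by (simp add: algebra_simps power2_eq_square)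
  qed
  have chi_cases: "chi v = \<theta>1 \<or> chi v = \<theta>2" if "v \<noteq> 0" for v
  proof -
    have "(chi v - \<theta>1) * (chi v - \<theta>2) = (chi v)\<^sup>2 - (\<theta>1 + \<theta>2) * chi v + \<theta>1 * \<theta>2"
      by (simp add: algebra_simps power2_eq_square)
    also have "\<dots> = 0"
      using quad[OF restricted_eigenvalue_chi[OF that]] unfolding vieta by linarith
    finally have "(chi v - \<theta>1) * (chi v - \<theta>2) = 0" .
    then show ?thesis by simp
  qed
  have wt: "wt u v = card {x. u * of_bool (x \<in> D) + T (v * x) \<noteq> 0}" for u v
  proof -
    \<comment> \<open>The origin is not a coordinate, but it contributes nothing: \<open>0\<close>
      is not in \<open>D\<close> and its trace is \<open>0\<close>.\<close>
    have "{x \<in> set xs. u * of_bool (x \<in> D) + T (v * x) \<noteq> 0} =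
        {x. u * of_bool (x \<in> D) + T (v * x) \<noteq> 0}"
      unfolding assms(16) using D0 by (intro Collect_cong) force
    then show ?thesis
      unfolding assms(17) codeword_def hamming_weight_map[OF assms(15)] by simp
  qed
  have wt_u0: "wt u 0 = k" if "u \<noteq> 0" for u
    using that k by (simp add: wt)
  have wt_0v: "wt 0 v = q ^ m - q ^ (m - 1)" if "v \<noteq> 0" for v
  proof -
    have "{x. T (v * x) \<noteq> 0} = - {x. T (v * x) = 0}" by auto
    then show ?thesis
      using card_trace_fibre[OF that, of 0] card_UNIV by (simp add: wt Compl_eq_Diff_UNIV card_Diff_subset)
  qed
  have wt_uv: "real (wt u v) = real (q ^ m) - real (q ^ (m - 1)) + chi v"
    if "u \<in> K" "u \<noteq> 0" "v \<noteq> 0" for u v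
    using card_codeword_support[OF that] by (simp add: wt)
  have wt_uv_pos: "wt u v \<noteq> 0" if u: "u \<in> K" "u \<noteq> 0" and v: "v \<noteq> 0" for u v
  proof
    \<comment> \<open>A zero codeword would make \<open>D\<close> the complement of a hyperplane and the graph complete
      multipartite, hence \<open>\<mu> = k\<close> and \<open>\<theta>1 * \<theta>2 = 0\<close>.\<close>
    assume "wt u v = 0"
    then have z: "u * of_bool (x \<in> D) + T (v * x) = 0" for x
      by (simp add: wt)
    have D: "x \<in> D \<longleftrightarrow> T (v * x) \<noteq> 0" for x
      using z[of x] u(2) by (cases "x \<in> D") auto
    obtain x y where xy: "x \<noteq> y" "\<not> cayley D x y"
      using srg unfolding strongly_regular_def by blast
    then have "T (v * x) = T (v * y)"
      by (simp add: cayley_def D right_diff_distrib trace_diff)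
    then have "cayley D x = cayley D y"
      by (auto simp: cayley_def D right_diff_distrib trace_diff fun_eq_iff)
    then have "{z. cayley D x z \<and> cayley D y z} = {z. cayley D x z}" by simp
    moreover have "card {z. cayley D x z \<and> cayley D y z} = \<mu>" "card {z. cayley D x z} = k"
      using srg xy unfolding strongly_regular_def by blast+
    ultimately have "\<theta>1 * \<theta>2 = 0" using vieta(2) by simp
    then show False using assms(10,12) by simp
  qed
  have wt_pos: "q ^ m - q ^ (m - 1) > 0"
    using q_gt_1 m by (simp add: power_strict_increasing)
  have zero: "{(u, v). u \<in> K \<and> wt u v = 0} = {(0, 0)}"
  proof -
    have "wt u v = 0 \<longleftrightarrow> u = 0 \<and> v = 0" if "u \<in> K" for u v
      using that wt_u0[of u] wt_0v[of v] wt_uv_pos[of u v] k_pos wt_pos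
      by (cases "u = 0"; cases "v = 0") (auto simp: wt[of 0 0])
    then show ?thesis by auto
  qed
  have card_K0: "card (K - {0}) = q - 1" using card_K by (simp add: card_Diff_singleton)
  \<comment> \<open>For \<open>u\<close> and \<open>v\<close> nonzero the weight depends on
    \<open>v\<close> alone, so each \<open>v\<close> is counted once for each of the
    \<open>q - 1\<close> values of \<open>u\<close>.\<close>
  have count: "card {(u, v). u \<in> K \<and> u \<noteq> 0 \<and> v \<noteq> 0 \<and>
      real (wt u v) = real (q ^ m) - real (q ^ (m - 1)) + \<theta>} = card ({v. chi v = \<theta>} - {0}) * (q - 1)"
    for \<theta>
  proof -
    have "{(u, v). u \<in> K \<and> u \<noteq> 0 \<and> v \<noteq> 0 \<and>
        real (wt u v) = real (q ^ m) - real (q ^ (m - 1)) + \<theta>} = (K - {0}) \<times> ({v. chi v = \<theta>} - {0})"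
      using wt_uv by auto
    then show ?thesis using card_K0 by (simp add: card_cartesian_product)
  qed
  have u_pairs: "{(u, v). u \<in> K \<and> u \<noteq> 0 \<and> v = (0::'a)} = (K - {0}) \<times> {0}"
    and v_pairs: "{(u, v). u \<in> K \<and> u = 0 \<and> v \<noteq> (0::'a)} = {0} \<times> (UNIV - {0})"
    by auto
  \<comment> \<open>Since \<open>chi 0 = k\<close>, excluding \<open>v = 0\<close> changes the count
    only for \<open>\<theta> = k\<close>, where the multiplicity also includes the constant
    eigenvector.\<close>
  have not_k: "card ({v. chi v = \<theta>} - {0}) = eigenvalue_multiplicity (adjacency_matrix (cayley D)) \<theta>"
    if "\<theta> \<noteq> real k" for \<theta>
    using that chi_0 k by (simp add: multiplicity_eq)
  have is_k: "card ({v. chi v = \<theta>} - {0}) = eigenvalue_multiplicity (adjacency_matrix (cayley D)) \<theta> - 1"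
    if "\<theta> = real k" for \<theta>
    using that chi_0 k by (simp add: multiplicity_eq card_Diff_singleton)
  have "\<theta>2 \<noteq> real k" using assms(12) by simp
  then show ?thesis
    unfolding zero u_pairs v_pairs count assms(13,14)
  proof (intro conjI ballI allI impI)
    show "card ((K - {0}) \<times> {0::'a}) = q - 1" "card ({0::'a} \<times> (UNIV - {0::'a})) = q ^ m - 1"
      using card_K0 card_UNIV by (simp_all add: card_cartesian_product card_Diff_singleton)
    fix u v :: 'a
    assume "u \<in> K - {0}" "v \<noteq> 0"
    then show "real (wt u v) = real (q ^ m) - real (q ^ (m - 1)) + \<theta>1 \<or>
        real (wt u v) = real (q ^ m) - real (q ^ (m - 1)) + \<theta>2"
      using wt_uv[of u v] chi_cases[of v] by auto
  qed (use wt_u0 wt_0v not_k is_k in auto)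
qed

end
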